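(* Any constant-error randomized communication protocol that computes a proper $(\Delta+1)$-coloring of $n$-vertex graphs in the two-party edge-partition model requires $\Omega(n)$ bits of communication in the worst case.
   Context: Two-party edge-partition model: the input is an undirected graph $G=(V,E)$ on vertex set $[n]$ with maximum degree $\Delta$; $E$ is partitioned into disjoint sets $E_A$ (Alice's) and $E_B$ (Bob's); both know $n$ and $\Delta$. At the end both players must agree on a coloring $C\in[\Delta+1]^n$, which must be proper ($C(u)\ne C(v)$ for every edge $\{u,v\}\in E$) with probability at least a constant bounded away from the trivial; constant-error means the protocol errs with probability at most some constant $\varepsilon<1/2$ on every input. *)

theory Defs
  imports "HOL-Probability.Probability_Mass_Function" "HOL-Library.Extended_Real"
begin

section \<open>Graphs on the vertex set [n]\<close>

type_synonym edges = "nat set set"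
type_synonym coloring = "nat \<Rightarrow> nat"

definition is_graph :: "nat \<Rightarrow> edges \<Rightarrow> bool" where
  "is_graph n E \<longleftrightarrow> (\<forall>e\<in>E. e \<subseteq> {1..n} \<and> card e = 2)"

definition degree :: "edges \<Rightarrow> nat \<Rightarrow> nat" where
  "degree E v = card {e \<in> E. v \<in> e}"

definition max_degree :: "nat \<Rightarrow> edges \<Rightarrow> nat" where
  "max_degree n E = Max (degree E ` {1..n})"

definition proper_coloring :: "nat \<Rightarrow> nat \<Rightarrow> edges \<Rightarrow> coloring \<Rightarrow> bool" where
  "proper_coloring n k E C \<longleftrightarrow>
     C \<in> {1..n} \<rightarrow> {1..k} \<and> (\<forall>u v. {u, v} \<in> E \<longrightarrow> C u \<noteq> C v)"

definition partitioned_inputs :: "nat \<Rightarrow> nat \<Rightarrow> (edges \<times> edges) set" where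
  "partitioned_inputs n \<Delta> =
     {(E\<^sub>A, E\<^sub>B). E\<^sub>A \<inter> E\<^sub>B = {} \<and> is_graph n (E\<^sub>A \<union> E\<^sub>B) \<and> max_degree n (E\<^sub>A \<union> E\<^sub>B) = \<Delta>}"


section \<open>Two-party communication protocols\<close>

text \<open>
  Protocol trees. At an inner node the named player sends one bit, computed from that player's
  own view (of type 'a for Alice, 'b for Bob); the bit 0 (False) leads to the first
  subtree and 1 (True) to the second. At a leaf, each player computes an output from their
  own view and from the position of the leaf, i.e. the transcript.
\<close>

datatype ('a, 'b, 'c) protocol =
    Output "'a \<Rightarrow> 'c" "'b \<Rightarrow> 'c"
  | Alice_Sends "'a \<Rightarrow> bool" "('a, 'b, 'c) protocol" "('a, 'b, 'c) protocol"
  | Bob_Sends "'b \<Rightarrow> bool" "('a, 'b, 'c) protocol" "('a, 'b, 'c) protocol"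

primrec transcript :: "('a, 'b, 'c) protocol \<Rightarrow> 'a \<Rightarrow> 'b \<Rightarrow> bool list" where
  "transcript (Output f g) x y = []"
| "transcript (Alice_Sends m P Q) x y =
     m x # (if m x then transcript Q x y else transcript P x y)"
| "transcript (Bob_Sends m P Q) x y =
     m y # (if m y then transcript Q x y else transcript P x y)"

primrec outputs :: "('a, 'b, 'c) protocol \<Rightarrow> 'a \<Rightarrow> 'b \<Rightarrow> 'c \<times> 'c" where
  "outputs (Output f g) x y = (f x, g y)"
| "outputs (Alice_Sends m P Q) x y = (if m x then outputs Q x y else outputs P x y)"
| "outputs (Bob_Sends m P Q) x y = (if m y then outputs Q x y else outputs P x y)"

text \<open>
  A randomized protocol has a public random string, which selects the protocol tree, and an
  independent private random string for each player, which is part of that player's view.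
  The distributions of the strings are arbitrary. The purely public-coin and the purely
  private-coin models are the special cases in which the other strings are constant.
\<close>

type_synonym coins = "bool list"
type_synonym view = "edges \<times> coins"

record randomized_protocol =
  public_coins :: "coins pmf"
  alice_coins :: "coins pmf"
  bob_coins :: "coins pmf"
  tree :: "coins \<Rightarrow> (view, view, coloring) protocol"

definition coin_pmf :: "randomized_protocol \<Rightarrow> (coins \<times> coins \<times> coins) pmf" where
  "coin_pmf \<pi> = pair_pmf (public_coins \<pi>) (pair_pmf (alice_coins \<pi>) (bob_coins \<pi>))"

definition bits_sent :: "randomized_protocol \<Rightarrow> edges \<Rightarrow> edges \<Rightarrow> coins \<times> coins \<times> coins \<Rightarrow> nat" where
  "bits_sent \<pi> E\<^sub>A E\<^sub>B = (\<lambda>(r, a, b). length (transcript (tree \<pi> r) (E\<^sub>A, a) (E\<^sub>B, b)))"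

text \<open>
  An execution succeeds if the two players agree on the vertex set and their common output
  is a proper coloring with colors in [k]; disagreement counts as an error.
\<close>

definition succeeds ::
  "nat \<Rightarrow> nat \<Rightarrow> randomized_protocol \<Rightarrow> edges \<Rightarrow> edges \<Rightarrow> coins \<times> coins \<times> coins \<Rightarrow> bool" where
  "succeeds n k \<pi> E\<^sub>A E\<^sub>B = (\<lambda>(r, a, b).
     let (C\<^sub>A, C\<^sub>B) = outputs (tree \<pi> r) (E\<^sub>A, a) (E\<^sub>B, b)
     in (\<forall>v\<in>{1..n}. C\<^sub>A v = C\<^sub>B v) \<and> proper_coloring n k (E\<^sub>A \<union> E\<^sub>B) C\<^sub>A)"

text \<open>
  Both players know n and the maximum degree, so for each n a protocol for the coloring problem
  is a family indexed by the maximum degree. The error bound is required on every input, and the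
  worst-case communication is taken over all maximum degrees, inputs and random strings
  (for maximum degree n - 1 alone no communication is needed).
\<close>

definition computes_coloring :: "real \<Rightarrow> nat \<Rightarrow> (nat \<Rightarrow> randomized_protocol) \<Rightarrow> bool" where
  "computes_coloring \<epsilon> n \<pi> \<longleftrightarrow>
     (\<forall>\<Delta>. \<forall>(E\<^sub>A, E\<^sub>B) \<in> partitioned_inputs n \<Delta>.
        measure_pmf.prob (coin_pmf (\<pi> \<Delta>)) {\<omega>. \<not> succeeds n (\<Delta> + 1) (\<pi> \<Delta>) E\<^sub>A E\<^sub>B \<omega>} \<le> \<epsilon>)"

definition worst_case_bits :: "nat \<Rightarrow> (nat \<Rightarrow> randomized_protocol) \<Rightarrow> enat" where
  "worst_case_bits n \<pi> =
     (SUP \<Delta>. SUP (E\<^sub>A, E\<^sub>B) \<in> partitioned_inputs n \<Delta>. SUP \<omega> \<in> set_pmf (coin_pmf (\<pi> \<Delta>)).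
        enat (bits_sent (\<pi> \<Delta>) E\<^sub>A E\<^sub>B \<omega>))"

end

theory Submission
  imports Defs
begin

text \<open>
  Alice holds a union of \<open>k = n div 4\<close> perfect matchings of blocks of four vertices, chosen
  independently among the three perfect matchings of each block, and Bob holds no edge, so the
  maximum degree is 1. No 2-coloring is proper for all three matchings of a block, hence each
  coloring is proper for at most \<open>2 ^ k\<close> of the \<open>3 ^ k\<close> inputs. If at most \<open>c\<close> bits are
  exchanged, then for fixed coins Bob has at most \<open>2 ^ c\<close> possible outputs, so the execution
  succeeds on at most \<open>2 ^ (c + k)\<close> inputs. Averaging over the coins gives
  \<open>(1 - \<epsilon>) 3 ^ k \<le> 2 ^ (c + k)\<close>.
\<close>

section \<open>Outputs that Bob can reach with few bits\<close>

text \<open>Bob's view \<open>y\<close> is fixed, so only Alice's bits branch: her bit splits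
  \<open>X\<close> into two parts, each continuing in its own subtree with one bit less to spend,
  while a bit of Bob leads all of \<open>X\<close> into the same subtree.\<close>

lemma card_receiver_outputs:
  assumes "\<And>x. x \<in> X \<Longrightarrow> length (transcript P x y) \<le> c"
  shows "finite ((\<lambda>x. snd (outputs P x y)) ` X) \<and>
    card ((\<lambda>x. snd (outputs P x y)) ` X) \<le> 2 ^ c"
  using assms
proof (induction P arbitrary: X c)
  case (Output f g)
  have "(\<lambda>x. snd (outputs (Output f g) x y)) ` X \<subseteq> {g y}"
    by auto
  from finite_subset[OF this] card_mono[OF _ this] show ?case
    using order_trans[OF _ one_le_power[of "2 :: nat" c]] by simp
next
  case (Alice_Sends m P Q)
  show ?case
  proof (cases "X = {}")
    case False
    \<comment> \<open>Some view in \<open>X\<close> has a transcript containing at least the bit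
      sent here, so \<open>c\<close> is positive; with \<open>X\<close> empty it could be 0.\<close>
    then obtain d where c: "c = Suc d"
      using Alice_Sends.prems by (cases c) fastforce+
    define F where "F R Y = (\<lambda>x. snd (outputs R x y)) ` Y"
      for R :: "('a, 'b, 'c) protocol" and Y
    have P: "finite (F P {x \<in> X. \<not> m x}) \<and> card (F P {x \<in> X. \<not> m x}) \<le> 2 ^ d"
      unfolding F_def using Alice_Sends.prems c by (intro Alice_Sends.IH(1)) fastforce
    have Q: "finite (F Q {x \<in> X. m x}) \<and> card (F Q {x \<in> X. m x}) \<le> 2 ^ d"
      unfolding F_def using Alice_Sends.prems c by (intro Alice_Sends.IH(2)) fastforce
    have "F (Alice_Sends m P Q) X = F P {x \<in> X. \<not> m x} \<union> F Q {x \<in> X. m x}"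
      unfolding F_def by (auto simp: image_iff; blast)
    moreover have "card (F P {x \<in> X. \<not> m x} \<union> F Q {x \<in> X. m x}) \<le> 2 ^ c"
      using P Q card_Un_le[of "F P {x \<in> X. \<not> m x}" "F Q {x \<in> X. m x}"] c by simp
    ultimately show ?thesis
      using P Q unfolding F_def by simp
  qed simp
next
  case (Bob_Sends m P Q)
  show ?case
  proof (cases "m y")
    case True
    then show ?thesis
      using Bob_Sends.IH(2)[of X c] Bob_Sends.prems by fastforce
  next
    case False
    then show ?thesis
      using Bob_Sends.IH(1)[of X c] Bob_Sends.prems by fastforce
  qed
qed

section \<open>The hard inputs\<close>

text \<open>The perfect matchings of the complete graph on block \<open>i\<close>. Every
  \<open>t\<close> above 1 gives the third one, so facts about degrees hold for arbitrary choice
  functions.\<close>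

definition block_matching :: "nat \<Rightarrow> nat \<Rightarrow> edges" where
  "block_matching i t =
     (if t = 0 then {{4*i+1, 4*i+2}, {4*i+3, 4*i+4}}
      else if t = 1 then {{4*i+1, 4*i+3}, {4*i+2, 4*i+4}}
      else {{4*i+1, 4*i+4}, {4*i+2, 4*i+3}})"

definition matching_union :: "nat \<Rightarrow> (nat \<Rightarrow> nat) \<Rightarrow> edges" where
  "matching_union k f = (\<Union>i<k. block_matching i (f i))"

abbreviation matching_choices :: "nat \<Rightarrow> (nat \<Rightarrow> nat) set" where
  "matching_choices k \<equiv> PiE {..<k} (\<lambda>_. {..<3})"

lemma block_matching_disjoint:
  assumes "e \<in> block_matching i t" "e' \<in> block_matching i t" "v \<in> e" "v \<in> e'"
  shows "e = e'"
  using assms unfolding block_matching_def by (auto split: if_splits)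

lemma block_matching_block:
  assumes "e \<in> block_matching i t" "v \<in> e"
  shows "i = (v - 1) div 4"
  using assms unfolding block_matching_def by (auto split: if_splits)

text \<open>A vertex determines its block, and edges within a block matching are disjoint, so no
  vertex lies on two edges.\<close>

lemma matching_union_in_partitioned_inputs:
  assumes "4 * k \<le> n" "0 < k"
  shows "(matching_union k f, {}) \<in> partitioned_inputs n 1"
proof -
  let ?E = "matching_union k f"
  have "is_graph n (block_matching i t)" if "i < k" for i t
    using that assms unfolding is_graph_def block_matching_def by auto
  then have graph: "is_graph n ?E"
    unfolding matching_union_def is_graph_def by blast
  have unique: "e = e'" if "e \<in> ?E" "e' \<in> ?E" "v \<in> e" "v \<in> e'" for e e' v
  proof -
    from that(1,2) obtain i j where ij: "e \<in> block_matching i (f i)" "e' \<in> block_matching j (f j)"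
      unfolding matching_union_def by blast
    then have "i = j"
      using block_matching_block that(3,4) by metis
    then show ?thesis
      using block_matching_disjoint[OF _ _ that(3,4)] ij by blast
  qed
  have le: "degree ?E v \<le> 1" for v
  proof (cases "{e \<in> ?E. v \<in> e} = {}")
    case False
    then obtain e where "e \<in> ?E" "v \<in> e"
      by blast
    then have "{e \<in> ?E. v \<in> e} = {e}"
      using unique by blast
    then show ?thesis
      unfolding degree_def by simp
  qed (simp add: degree_def del: Collect_empty_eq)
  \<comment> \<open>The maximum degree must be exactly 1; vertex 1 attains it, as block 0 is present
    for positive \<open>k\<close>.\<close>
  have "\<exists>e \<in> block_matching 0 (f 0). 1 \<in> e"
    unfolding block_matching_def by auto
  then obtain e where "e \<in> ?E" "1 \<in> e"
    using assms unfolding matching_union_def by blast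
  then have "{e \<in> ?E. 1 \<in> e} = {e}"
    using unique by blast
  then have "degree ?E 1 = 1"
    unfolding degree_def by simp
  moreover have "1 \<in> {1..n}"
    using assms by simp
  ultimately have "1 \<in> degree ?E ` {1..n}"
    by (metis imageI)
  with le have "max_degree n ?E = 1"
    unfolding max_degree_def by (intro Max_eqI) auto
  with graph show ?thesis
    unfolding partitioned_inputs_def by simp
qed

text \<open>Two colors cannot separate three vertices pairwise, and the three pairs among the first
  three vertices of a block lie in different matchings. Hence each block rules out one of its three
  choices.\<close>

lemma card_properly_colored_matchings:
  assumes "4 * k \<le> n"
  shows "card {f \<in> matching_choices k. proper_coloring n 2 (matching_union k f) C} \<le> 2 ^ k"
proof (cases "C \<in> {1..n} \<rightarrow> {1..2}")
  case True
  define S where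
    "S i = {t \<in> {..<3}. \<forall>u v. {u, v} \<in> block_matching i t \<longrightarrow> C u \<noteq> C v}" for i
  have card: "card (S i) \<le> 2" if "i < k" for i
  proof -
    have "C v = 1 \<or> C v = 2" if "v \<in> {4*i+1, 4*i+2, 4*i+3, 4*i+4}" for v
    proof -
      have "v \<in> {1..n}"
        using that \<open>i < k\<close> assms by auto
      with True have "C v \<in> {1..2}"
        by blast
      then show ?thesis
        by auto
    qed
    then have colors: "C (4*i+1) = 1 \<or> C (4*i+1) = 2" "C (4*i+2) = 1 \<or> C (4*i+2) = 2"
      "C (4*i+3) = 1 \<or> C (4*i+3) = 2"
      by blast+
    have "C (4*i+1) \<noteq> C (4*i+2)" if "0 \<in> S i"
      using that unfolding S_def block_matching_def by auto
    moreover have "C (4*i+1) \<noteq> C (4*i+3)" if "1 \<in> S i"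
      using that unfolding S_def block_matching_def by auto
    moreover have "C (4*i+2) \<noteq> C (4*i+3)" if "2 \<in> S i"
      using that unfolding S_def block_matching_def by auto
    ultimately have "\<not> {0, 1, 2} \<subseteq> S i"
      using colors by auto
    moreover have "{0, 1, 2} = {..<3 :: nat}"
      by auto
    ultimately have "S i \<subset> {..<3}"
      unfolding S_def by auto
    from psubset_card_mono[OF _ this] show ?thesis
      by simp
  qed
  have "{f \<in> matching_choices k. proper_coloring n 2 (matching_union k f) C}
      \<subseteq> PiE {..<k} S"
  proof
    fix f
    assume f: "f \<in> {f \<in> matching_choices k. proper_coloring n 2 (matching_union k f) C}"
    have "f i \<in> S i" if "i < k" for i
      using f that unfolding S_def proper_coloring_def matching_union_def by blast
    with f show "f \<in> PiE {..<k} S"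
      by (auto simp: PiE_iff)
  qed
  moreover have "finite (PiE {..<k} S)"
    unfolding S_def by (intro finite_PiE) auto
  ultimately have "card {f \<in> matching_choices k. proper_coloring n 2 (matching_union k f) C}
      \<le> card (PiE {..<k} S)"
    by (rule card_mono[rotated])
  also have "\<dots> = (\<Prod>i<k. card (S i))"
    by (simp add: card_PiE)
  also have "\<dots> \<le> (\<Prod>i<k. 2)"
    using card by (intro prod_mono) auto
  finally show ?thesis
    by simp
next
  case False
  then show ?thesis
    unfolding proper_coloring_def by simp
qed

section \<open>From fixed coins to randomized protocols\<close>

lemma card_successful_matchings:
  assumes "4 * k \<le> n"
    and "\<And>f. f \<in> matching_choices k \<Longrightarrow> bits_sent \<pi> (matching_union k f) {} \<omega> \<le> c"
  shows "card {f \<in> matching_choices k. succeeds n 2 \<pi> (matching_union k f) {} \<omega>}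
    \<le> 2 ^ c * 2 ^ k"
proof -
  obtain r a b where \<omega>: "\<omega> = (r, a, b)"
    by (cases \<omega>)
  define X where "X = (\<lambda>f. (matching_union k f, a)) ` matching_choices k"
  define \<C> where "\<C> = (\<lambda>x. snd (outputs (tree \<pi> r) x ({}, b))) ` X"
  define G where "G C = {f \<in> matching_choices k. proper_coloring n 2 (matching_union k f) C}"
    for C
  have \<C>: "finite \<C> \<and> card \<C> \<le> 2 ^ c"
    unfolding \<C>_def using assms(2)
    by (intro card_receiver_outputs) (auto simp: X_def bits_sent_def \<omega>)
  have G: "finite (G C)" for C
    unfolding G_def by (simp add: finite_PiE)
  have "{f \<in> matching_choices k. succeeds n 2 \<pi> (matching_union k f) {} \<omega>} \<subseteq> (\<Union>C\<in>\<C>. G C)"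
  proof
    fix f
    assume f: "f \<in> {f \<in> matching_choices k. succeeds n 2 \<pi> (matching_union k f) {} \<omega>}"
    let ?E = "matching_union k f"
    obtain C D where out: "outputs (tree \<pi> r) (?E, a) ({}, b) = (C, D)"
      by fastforce
    with f have agree: "\<forall>v\<in>{1..n}. C v = D v" and C: "proper_coloring n 2 ?E C"
      unfolding succeeds_def \<omega> by auto
    \<comment> \<open>Success asserts properness of Alice's output \<open>C\<close>, and agreement
      with Bob's output \<open>D\<close> only on the vertex set. Since all edges stay inside that
      set, properness carries over to \<open>D\<close>, which is the output being counted.\<close>
    have "u \<in> {1..n} \<and> v \<in> {1..n}" if "{u, v} \<in> ?E" for u v
      using that assms(1) unfolding matching_union_def block_matching_def
      by (auto simp: doubleton_eq_iff split: if_splits)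
    with agree C have "proper_coloring n 2 ?E D"
      unfolding proper_coloring_def by (auto simp: Pi_iff)
    moreover have "D \<in> \<C>"
      using f out unfolding \<C>_def X_def by (force simp: image_iff)
    ultimately show "f \<in> (\<Union>C\<in>\<C>. G C)"
      using f unfolding G_def by auto
  qed
  then have "card {f \<in> matching_choices k. succeeds n 2 \<pi> (matching_union k f) {} \<omega>}
      \<le> card (\<Union>C\<in>\<C>. G C)"
    using \<C> G by (intro card_mono) auto
  also have "\<dots> \<le> (\<Sum>C\<in>\<C>. card (G C))"
    using \<C> by (intro card_UN_le) simp
  also have "\<dots> \<le> (\<Sum>C\<in>\<C>. 2 ^ k)"
    using card_properly_colored_matchings[OF assms(1)] unfolding G_def by (intro sum_mono)
  also have "\<dots> \<le> 2 ^ c * 2 ^ k"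
    using \<C> by simp
  finally show ?thesis .
qed

text \<open>By linearity the sum is the expected number of \<open>i\<close> for which
  \<open>Q i\<close> holds, and this number is at most \<open>K\<close> on the support.\<close>

lemma sum_prob_le_of_card_le:
  fixes p :: "'a pmf" and K :: nat
  assumes "finite I"
    and "\<And>\<omega>. \<omega> \<in> set_pmf p \<Longrightarrow> card {i \<in> I. Q i \<omega>} \<le> K"
  shows "(\<Sum>i\<in>I. measure_pmf.prob p {\<omega>. Q i \<omega>}) \<le> real K"
proof -
  have integrable: "integrable p (indicat_real {\<omega>. Q i \<omega>})" for i
    by (rule measure_pmf.integrable_const_bound[where B = 1]) auto
  have "(\<Sum>i\<in>I. measure_pmf.prob p {\<omega>. Q i \<omega>})
      = (\<Sum>i\<in>I. measure_pmf.expectation p (indicator {\<omega>. Q i \<omega>}))"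
    by simp
  also have "\<dots> = measure_pmf.expectation p (\<lambda>\<omega>. \<Sum>i\<in>I. indicator {\<omega>. Q i \<omega>} \<omega>)"
    by (rule Bochner_Integration.integral_sum[symmetric]) (rule integrable)
  also have "\<dots> \<le> measure_pmf.expectation p (\<lambda>_. real K)"
  proof (rule integral_mono_AE)
    have "(\<Sum>i\<in>I. indicator {\<omega>. Q i \<omega>} \<omega>) = real (card {i \<in> I. Q i \<omega>})" for \<omega>
      using assms(1) by (simp add: indicator_def sum.If_cases Int_def)
    then show "AE \<omega> in measure_pmf p. (\<Sum>i\<in>I. indicator {\<omega>. Q i \<omega>} \<omega>) \<le> real K"
      using assms(2) by (simp add: AE_measure_pmf_iff)
  qed (simp_all add: integrable)
  finally show ?thesis
    by simp
qed

lemma computes_coloring_exponential_bound: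
  assumes "computes_coloring \<epsilon> n \<pi>" "worst_case_bits n \<pi> \<le> enat c" "4 * k \<le> n" "0 < k"
  shows "(1 - \<epsilon>) * 3 ^ k \<le> 2 ^ c * 2 ^ k"
proof -
  let ?p = "coin_pmf (\<pi> 1)"
  let ?S = "\<lambda>f. {\<omega>. succeeds n 2 (\<pi> 1) (matching_union k f) {} \<omega>}"
  note inputs = matching_union_in_partitioned_inputs[OF assms(3,4)]
  have "bits_sent (\<pi> 1) (matching_union k f) {} \<omega> \<le> c" if "\<omega> \<in> set_pmf ?p" for f \<omega>
  proof -
    have "enat (bits_sent (\<pi> 1) (matching_union k f) {} \<omega>) \<le> worst_case_bits n \<pi>"
      unfolding worst_case_bits_def
      \<comment> \<open>The supremum ranges over all maximum degrees; the term for degree 1 is the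
        relevant one.\<close>
      by (rule SUP_upper2[where i = 1, OF UNIV_I], rule SUP_upper2[OF inputs[of f]])
        (use that in \<open>auto intro: SUP_upper\<close>)
    with assms(2) show ?thesis
      by (meson enat_ord_simps(1) order_trans)
  qed
  then have "(\<Sum>f\<in>matching_choices k. measure_pmf.prob ?p (?S f)) \<le> real (2 ^ c * 2 ^ k)"
    using card_successful_matchings[OF assms(3)]
    by (intro sum_prob_le_of_card_le) (auto intro: finite_PiE)
  moreover have "1 - \<epsilon> \<le> measure_pmf.prob ?p (?S f)" for f
  proof -
    have "measure_pmf.prob ?p (- ?S f) \<le> \<epsilon>"
      using assms(1) inputs[of f] unfolding computes_coloring_def Compl_eq
      by (fastforce simp: numeral_2_eq_2)
    then show ?thesis
      using measure_pmf.prob_compl[of "?S f" ?p] by (simp add: Compl_eq_Diff_UNIV)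
  qed
  then have "(\<Sum>f\<in>matching_choices k. 1 - \<epsilon>)
      \<le> (\<Sum>f\<in>matching_choices k. measure_pmf.prob ?p (?S f))"
    by (intro sum_mono)
  ultimately show ?thesis
    by (simp add: card_PiE mult.commute)
qed

text \<open>Squaring the hypothesis and using 8 \<le> 9 leaves only powers of 2, whose exponents can
  be compared.\<close>

lemma le_of_three_power_le_two_power:
  assumes "(3 :: real) ^ k \<le> 2 ^ (c + k + 1)"
  shows "k \<le> 2 * c + 2"
proof -
  have "(2 :: real) ^ (3 * k) = 8 ^ k"
    by (simp add: power_mult)
  also have "\<dots> \<le> 9 ^ k"
    by (intro power_mono) auto
  also have "\<dots> = (3 ^ k)\<^sup>2"
    by (simp add: power2_eq_square flip: power_mult_distrib)
  also have "\<dots> \<le> (2 ^ (c + k + 1))\<^sup>2"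
    using assms by (intro power_mono) auto
  also have "\<dots> = 2 ^ (2 * (c + k + 1))"
    by (simp add: mult.commute flip: power_mult)
  finally have "3 * k \<le> 2 * (c + k + 1)"
    by (subst (asm) power_increasing_iff) auto
  then show ?thesis
    by simp
qed

theorem theorem5p1:
  fixes \<epsilon> :: real
  assumes "0 \<le> \<epsilon>" and "\<epsilon> < 1 / 2"
  shows "\<exists>c>0. \<exists>N. \<forall>n\<ge>N. \<forall>\<pi> :: nat \<Rightarrow> randomized_protocol.
    computes_coloring \<epsilon> n \<pi> \<longrightarrow>
      ereal (c * real n) \<le> ereal_of_enat (worst_case_bits n \<pi>)"
proof -
  \<comment> \<open>With \<open>k = n div 4\<close>, the bound \<open>k \<le> 2 * c + 2\<close>
    gives \<open>n \<le> 8 * c + 11\<close>. For \<open>n \<ge> 40\<close> this forces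
    \<open>c \<ge> 4\<close>, so 11 is absorbed into another \<open>8 * c\<close>.\<close>
  have "ereal (1 / 16 * real n) \<le> ereal_of_enat (worst_case_bits n \<pi>)"
    if n: "n \<ge> 40" and \<pi>: "computes_coloring \<epsilon> n \<pi>" for n \<pi>
  proof (cases "worst_case_bits n \<pi>")
    case (enat c)
    define k where "k = n div 4"
    have "(1 - \<epsilon>) * 3 ^ k \<le> 2 ^ c * 2 ^ k"
      using computes_coloring_exponential_bound[OF \<pi>, of c k] enat n
      unfolding k_def by simp
    \<comment> \<open>Replacing the success probability by 1/2 costs one factor of 2, the
      \<open>+ 1\<close> in the exponent below.\<close>
    moreover have "1 / 2 * 3 ^ k \<le> (1 - \<epsilon>) * 3 ^ k"
      using assms by (intro mult_right_mono) auto
    ultimately have "1 / 2 * (3 :: real) ^ k \<le> 2 ^ c * 2 ^ k"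
      by linarith
    then have "(3 :: real) ^ k \<le> 2 ^ (c + k + 1)"
      by (simp add: power_add)
    then have "k \<le> 2 * c + 2"
      by (rule le_of_three_power_le_two_power)
    then have "n \<le> 16 * c"
      using n unfolding k_def by linarith
    then have "real n \<le> 16 * real c"
      by (metis of_nat_le_iff of_nat_mult of_nat_numeral)
    then show ?thesis
      using enat by simp
  qed simp
  then show ?thesis
    by (intro exI[of _ "1 / 16 :: real"] conjI exI[of _ 40]) auto
qed

end
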